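(* The metric $M_{BIC}(\mathcal{G},\vec C)=\log M_{ML}(\mathcal{G},\vec C)-\frac12\mathrm{Dim}(\mathcal{G})\log N$, where $N$ is the number of cases in $\vec C$, is score equivalent; that is, for all dags $\mathcal{G},\mathcal{G}'$ over the same set of variables and every database $\vec C$, $\mathcal{G}\approx\mathcal{G}'$ implies $M_{BIC}(\mathcal{G},\vec C)=M_{BIC}(\mathcal{G}',\vec C)$.
   Context: All graphs have the same finite vertex set $U=\{x_1,\dots,x_n\}$; a dag is an acyclic directed graph on $U$. Each node $x_i$ is a discrete variable with a finite number $r_i\ge 2$ of states. $\Pi_i^{\mathcal{G}}$ denotes the set of parents of $x_i$ in $\mathcal{G}$. A Bayesian network with structure $\mathcal{G}$ is a pair $(\mathcal{G},\theta_{\mathcal{G}})$ where $\theta_{\mathcal{G}}$ is a collection of conditional distributions $p(x_i\mid\Pi_i^{\mathcal{G}})$; it defines the joint distribution $\prod_i p(x_i\mid\Pi_i^{\mathcal{G}})$. Two dags are equivalent, written $\mathcal{G}\approx\mathcal{G}'$, if for every Bayesian network $(\mathcal{G},\theta_{\mathcal{G}})$ there is a Bayesian network $(\mathcal{G}',\theta_{\mathcal{G}'})$ defining the same joint distribution, and vice versa. Known fact (Verma and Pearl): $\mathcal{G}\approx\mathcal{G}'$ if and only if they have the same skeleton (underlying undirected graph) and the same v-structures (ordered triples $(x,y,z)$ of distinct nodes with $x\to y$, $z\to y$ and $x,z$ not adjacent). A database $\vec C=\{C_1,\dots,C_N\}$, $N\ge1$, consists of $N$ cases, each a full assignment of states to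 all variables in $U$. The likelihood $L(\mathcal{G},\theta_{\mathcal{G}},\vec C)$ is the probability of the data under $(\mathcal{G},\theta_{\mathcal{G}})$, i.e. the product over $l=1,\dots,N$ of the probability of $C_l$ under the joint distribution defined by $(\mathcal{G},\theta_{\mathcal{G}})$. The maximum likelihood metric is $M_{ML}(\mathcal{G},\vec C)=\max_{\theta_{\mathcal{G}}}L(\mathcal{G},\theta_{\mathcal{G}},\vec C)$. The number of parameters is $\mathrm{Dim}(\mathcal{G})=\sum_{i=1}^n(r_i-1)\prod_{x_j\in\Pi_i^{\mathcal{G}}}r_j$. *)

theory Defs
  imports "HOL-Probability.Probability"
begin

text \<open>
  A directed graph on \<open>U\<close> is given by its arc relation, with \<open>(y, x)\<close> for the arc from \<open>y\<close>
  to \<open>x\<close>. The set of states of the variable \<open>x\<close> is \<open>S x\<close>, so its number of states is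
  \<open>card (S x)\<close>. An assignment of states to the variables in \<open>A\<close> is an element of \<open>PiE A S\<close>.
\<close>

definition dag :: "'v set \<Rightarrow> 'v rel \<Rightarrow> bool" where
  "dag U G \<longleftrightarrow> G \<subseteq> U \<times> U \<and> acyclic G"

definition parents :: "'v rel \<Rightarrow> 'v \<Rightarrow> 'v set" where
  "parents G x = {y. (y, x) \<in> G}"

text \<open>
  \<open>\<theta> x \<pi>\<close> is the conditional distribution of \<open>x\<close> given the assignment \<open>\<pi>\<close> to the
  parents of \<open>x\<close>.
\<close>

type_synonym ('v, 's) cond_dists = "'v \<Rightarrow> ('v \<Rightarrow> 's) \<Rightarrow> 's pmf"

definition bayes_net ::
  "'v set \<Rightarrow> ('v \<Rightarrow> 's set) \<Rightarrow> 'v rel \<Rightarrow> ('v, 's) cond_dists \<Rightarrow> bool" where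
  "bayes_net U S G \<theta> \<longleftrightarrow>
     dag U G \<and> (\<forall>x\<in>U. \<forall>\<pi>\<in>PiE (parents G x) S. set_pmf (\<theta> x \<pi>) \<subseteq> S x)"

definition joint ::
  "'v set \<Rightarrow> 'v rel \<Rightarrow> ('v, 's) cond_dists \<Rightarrow> ('v \<Rightarrow> 's) \<Rightarrow> real" where
  "joint U G \<theta> c = (\<Prod>x\<in>U. pmf (\<theta> x (restrict c (parents G x))) (c x))"

definition dag_equiv :: "'v set \<Rightarrow> ('v \<Rightarrow> 's set) \<Rightarrow> 'v rel \<Rightarrow> 'v rel \<Rightarrow> bool" where
  "dag_equiv U S G G' \<longleftrightarrow>
     (\<forall>\<theta>. bayes_net U S G \<theta> \<longrightarrow>
        (\<exists>\<theta>'. bayes_net U S G' \<theta>' \<and> (\<forall>c\<in>PiE U S. joint U G' \<theta>' c = joint U G \<theta> c))) \<and>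
     (\<forall>\<theta>'. bayes_net U S G' \<theta>' \<longrightarrow>
        (\<exists>\<theta>. bayes_net U S G \<theta> \<and> (\<forall>c\<in>PiE U S. joint U G \<theta> c = joint U G' \<theta>' c)))"

text \<open>A database is a list, since the same case may occur several times.\<close>

definition database :: "'v set \<Rightarrow> ('v \<Rightarrow> 's set) \<Rightarrow> ('v \<Rightarrow> 's) list \<Rightarrow> bool" where
  "database U S C \<longleftrightarrow> C \<noteq> [] \<and> set C \<subseteq> PiE U S"

definition likelihood ::
  "'v set \<Rightarrow> 'v rel \<Rightarrow> ('v, 's) cond_dists \<Rightarrow> ('v \<Rightarrow> 's) list \<Rightarrow> real" where
  "likelihood U G \<theta> C = (\<Prod>l<length C. joint U G \<theta> (C ! l))"

text \<open>
  The likelihoods range over an infinite set, so the maximum is expressed by \<^const>\<open>Greatest\<close>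
  rather than \<^const>\<open>Max\<close>; \<open>M_ML_attained\<close> below shows that it exists, and \<open>M_ML_pos\<close> that
  its logarithm is meaningful.
\<close>

definition M_ML ::
  "'v set \<Rightarrow> ('v \<Rightarrow> 's set) \<Rightarrow> 'v rel \<Rightarrow> ('v \<Rightarrow> 's) list \<Rightarrow> real" where
  "M_ML U S G C = (GREATEST m. \<exists>\<theta>. bayes_net U S G \<theta> \<and> m = likelihood U G \<theta> C)"

definition Dim :: "'v set \<Rightarrow> ('v \<Rightarrow> 's set) \<Rightarrow> 'v rel \<Rightarrow> nat" where
  "Dim U S G = (\<Sum>x\<in>U. (card (S x) - 1) * (\<Prod>y\<in>parents G x. card (S y)))"

definition M_BIC ::
  "'v set \<Rightarrow> ('v \<Rightarrow> 's set) \<Rightarrow> 'v rel \<Rightarrow> ('v \<Rightarrow> 's) list \<Rightarrow> real" where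
  "M_BIC U S G C = ln (M_ML U S G C) - 1 / 2 * real (Dim U S G) * ln (real (length C))"

definition score_equivalent ::
  "'v set \<Rightarrow> ('v \<Rightarrow> 's set) \<Rightarrow> ('v rel \<Rightarrow> ('v \<Rightarrow> 's) list \<Rightarrow> real) \<Rightarrow> bool" where
  "score_equivalent U S M \<longleftrightarrow>
     (\<forall>G G' C. dag U G \<longrightarrow> dag U G' \<longrightarrow> database U S C \<longrightarrow> dag_equiv U S G G' \<longrightarrow> M G C = M G' C)"

lemma ex_max_likelihood:
  fixes S :: "'v \<Rightarrow> 's set"
  assumes U: "finite U" and S: "\<forall>x\<in>U. finite (S x) \<and> 2 \<le> card (S x)"
    and G: "dag U G" and C: "database U S C"
  shows "\<exists>\<theta>. bayes_net U S G \<theta> \<and>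
           (\<forall>\<theta>'. bayes_net U S G \<theta>' \<longrightarrow> likelihood U G \<theta>' C \<le> likelihood U G \<theta> C)"
proof -
  have par: "parents G x \<subseteq> U" for x
    using G by (auto simp: dag_def parents_def)
  define J where "J = (SIGMA x:U. PiE (parents G x) S)"
  define I where "I = {(x, \<pi>, s). (x, \<pi>) \<in> J \<and> s \<in> S x}"
  define K :: "('v \<times> ('v \<Rightarrow> 's) \<times> 's \<Rightarrow> real) set"
    where "K = Pi\<^sub>E UNIV (\<lambda>i. if i \<in> I then {0..1} else {0}) \<inter>
               (\<Inter>(x, \<pi>)\<in>J. {f. (\<Sum>s\<in>S x. f (x, \<pi>, s)) = 1})"
  define L :: "('v \<times> ('v \<Rightarrow> 's) \<times> 's \<Rightarrow> real) \<Rightarrow> real"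
    where "L f = (\<Prod>l<length C. \<Prod>x\<in>U. f (x, restrict (C ! l) (parents G x), (C ! l) x))" for f
  define par_of :: "('v, 's) cond_dists \<Rightarrow> 'v \<times> ('v \<Rightarrow> 's) \<times> 's \<Rightarrow> real"
    where "par_of \<theta> = (\<lambda>(x, \<pi>, s). if (x, \<pi>, s) \<in> I then pmf (\<theta> x \<pi>) s else 0)" for \<theta>
  have index: "(x, restrict (C ! l) (parents G x), (C ! l) x) \<in> I"
    if "l < length C" "x \<in> U" for l x
  proof -
    have "C ! l \<in> PiE U S"
      using C that by (meson database_def nth_mem subsetD)
    then show ?thesis
      using par that by (auto simp: I_def J_def)
  qed
  have L_par_of: "L (par_of \<theta>) = likelihood U G \<theta> C" for \<theta>
    unfolding L_def likelihood_def joint_def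
    by (intro prod.cong refl) (auto simp: par_of_def index)
  have par_of_K: "par_of \<theta> \<in> K" if "bayes_net U S G \<theta>" for \<theta>
  proof -
    have "(\<Sum>s\<in>S x. par_of \<theta> (x, \<pi>, s)) = 1" if "(x, \<pi>) \<in> J" for x \<pi>
    proof -
      have "(\<Sum>s\<in>S x. par_of \<theta> (x, \<pi>, s)) = (\<Sum>s\<in>S x. pmf (\<theta> x \<pi>) s)"
        using that by (intro sum.cong) (auto simp: par_of_def I_def)
      also have "\<dots> = 1"
        using \<open>bayes_net U S G \<theta>\<close> S that
        by (intro sum_pmf_eq_1) (auto simp: bayes_net_def J_def)
      finally show ?thesis .
    qed
    then show ?thesis
      by (auto simp: K_def par_of_def PiE_iff pmf_le_1)
  qed
  have surj: "\<exists>\<theta>. bayes_net U S G \<theta> \<and> likelihood U G \<theta> C = L f" if f: "f \<in> K" for f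
  proof -
    have nonneg: "0 \<le> f i" and out: "i \<notin> I \<Longrightarrow> f i = 0" for i
    proof -
      have "f i \<in> (if i \<in> I then {0..1} else {0})"
        using PiE_mem[OF IntD1[OF f[unfolded K_def]] UNIV_I] .
      then show "0 \<le> f i" and "i \<notin> I \<Longrightarrow> f i = 0"
        by (auto split: if_splits)
    qed
    define \<theta> :: "('v, 's) cond_dists"
      where "\<theta> x \<pi> = embed_pmf (\<lambda>s. f (x, \<pi>, s))" for x \<pi>
    have pmf_\<theta>: "pmf (\<theta> x \<pi>) s = f (x, \<pi>, s)" if "(x, \<pi>) \<in> J" for x \<pi> s
    proof -
      have fin: "finite (S x)"
        using that S by (auto simp: J_def)
      have "(\<integral>\<^sup>+ s. ennreal (f (x, \<pi>, s)) \<partial>count_space UNIV)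
          = (\<integral>\<^sup>+ s. ennreal (f (x, \<pi>, s)) \<partial>count_space (S x))"
        by (intro nn_integral_count_space_eq) (auto simp: out I_def)
      also have "\<dots> = ennreal (\<Sum>s\<in>S x. f (x, \<pi>, s))"
        using fin by (simp add: nn_integral_count_space_finite nonneg sum_ennreal)
      also have "\<dots> = 1"
        using f that by (auto simp: K_def)
      finally show ?thesis
        unfolding \<theta>_def by (intro pmf_embed_pmf nonneg)
    qed
    have "bayes_net U S G \<theta>"
      unfolding bayes_net_def
    proof (intro conjI ballI subsetI G)
      fix x \<pi> s assume "x \<in> U" "\<pi> \<in> PiE (parents G x) S" "s \<in> set_pmf (\<theta> x \<pi>)"
      then have "f (x, \<pi>, s) \<noteq> 0"
        using pmf_\<theta>[of x \<pi> s] by (auto simp: J_def set_pmf_iff)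
      then show "s \<in> S x"
        using out[of "(x, \<pi>, s)"] by (auto simp: I_def)
    qed
    moreover have "likelihood U G \<theta> C = L f"
      unfolding L_def likelihood_def joint_def
    proof (intro prod.cong refl)
      fix l x assume "l \<in> {..<length C}" "x \<in> U"
      then show "pmf (\<theta> x (restrict (C ! l) (parents G x))) ((C ! l) x)
               = f (x, restrict (C ! l) (parents G x), (C ! l) x)"
        using index[of l x] by (intro pmf_\<theta>) (auto simp: I_def)
    qed
    ultimately show ?thesis by blast
  qed
  have cont: "continuous_on A (\<lambda>f :: 'v \<times> ('v \<Rightarrow> 's) \<times> 's \<Rightarrow> real. f i)" for A i
    by (rule continuous_on_subset[OF continuous_on_product_coordinates subset_UNIV])
  have "compact K"
  proof -
    have "compactin (product_topology (\<lambda>i. euclidean) UNIV)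
            (Pi\<^sub>E UNIV (\<lambda>i. if i \<in> I then {0..1::real} else {0}))"
      by (subst compactin_PiE) auto
    then have "compact (Pi\<^sub>E UNIV (\<lambda>i. if i \<in> I then {0..1::real} else {0}))"
      by (simp add: euclidean_product_topology)
    moreover have "closed {f :: 'v \<times> ('v \<Rightarrow> 's) \<times> 's \<Rightarrow> real. (\<Sum>s\<in>S x. f (x, \<pi>, s)) = 1}"
      for x \<pi>
      by (intro closed_Collect_eq continuous_on_sum cont continuous_on_const)
    ultimately show ?thesis
      unfolding K_def by (intro compact_Int_closed closed_INT) auto
  qed
  moreover have "K \<noteq> {}"
  proof -
    have "S x \<noteq> {}" if "x \<in> U" for x
      using S that by force
    then have "bayes_net U S G (\<lambda>x \<pi>. pmf_of_set (S x))"
      using S G by (auto simp: bayes_net_def)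
    then show ?thesis
      using par_of_K by blast
  qed
  moreover have "continuous_on K L"
    unfolding L_def by (intro continuous_on_prod cont)
  ultimately obtain f where "f \<in> K" "\<forall>g\<in>K. L g \<le> L f"
    using continuous_attains_sup by blast
  moreover from this obtain \<theta> where "bayes_net U S G \<theta>" "likelihood U G \<theta> C = L f"
    using surj by blast
  ultimately show ?thesis
    using par_of_K L_par_of by (intro exI[of _ \<theta>]) force
qed

lemma M_ML_attained:
  assumes "finite U" "\<forall>x\<in>U. finite (S x) \<and> 2 \<le> card (S x)" "dag U G" "database U S C"
  shows "\<exists>\<theta>. bayes_net U S G \<theta> \<and> likelihood U G \<theta> C = M_ML U S G C"
    and "bayes_net U S G \<theta> \<Longrightarrow> likelihood U G \<theta> C \<le> M_ML U S G C"
proof -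
  obtain \<theta>0 where 0: "bayes_net U S G \<theta>0"
    "\<And>\<theta>'. bayes_net U S G \<theta>' \<Longrightarrow> likelihood U G \<theta>' C \<le> likelihood U G \<theta>0 C"
    using ex_max_likelihood[OF assms] by blast
  have "M_ML U S G C = likelihood U G \<theta>0 C"
    unfolding M_ML_def using 0 by (intro Greatest_equality) auto
  then show "\<exists>\<theta>. bayes_net U S G \<theta> \<and> likelihood U G \<theta> C = M_ML U S G C"
    and "bayes_net U S G \<theta> \<Longrightarrow> likelihood U G \<theta> C \<le> M_ML U S G C"
    using 0 by auto
qed

lemma M_ML_pos:
  assumes "finite U" "\<forall>x\<in>U. finite (S x) \<and> 2 \<le> card (S x)" "dag U G" "database U S C"
  shows "0 < M_ML U S G C"
proof -
  let ?\<theta> = "\<lambda>x \<pi>. pmf_of_set (S x)"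
  have ne: "S x \<noteq> {}" if "x \<in> U" for x
    using assms(2) that by force
  have "bayes_net U S G ?\<theta>"
    using assms ne by (auto simp: bayes_net_def)
  moreover have "0 < likelihood U G ?\<theta> C"
    unfolding likelihood_def joint_def
  proof (intro prod_pos)
    fix l x assume "l \<in> {..<length C}" "x \<in> U"
    moreover from this have "C ! l \<in> PiE U S"
      using assms(4) by (meson database_def lessThan_iff nth_mem subsetD)
    ultimately show "0 < pmf (pmf_of_set (S x)) ((C ! l) x)"
      using assms(2) ne[OF \<open>x \<in> U\<close>] PiE_mem[of "C ! l" U S x]
      by (simp add: card_gt_0_iff)
  qed
  ultimately show ?thesis
    using M_ML_attained(2)[OF assms] by fastforce
qed

end

theory Submission
  imports Defs
begin

text \<open>
  Equivalent dags admit the same likelihoods, so only the dimensions need an argument. Expanding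
  \<open>\<Prod>r\<^sub>j = \<Prod>(1 + (r\<^sub>j - 1))\<close> over the parents writes \<open>Dim G\<close> as the sum of
  \<open>\<Prod>a\<in>A. (r\<^sub>a - 1)\<close> over all sets \<open>A = {x} \<union> B\<close> with \<open>B\<close> a set of parents of \<open>x\<close>;
  acyclicity makes each \<open>A\<close> occur once. It remains to see that the joint distributions
  determine this collection of sets. For such an \<open>A\<close>, the uniform distribution perturbed by a pure
  interaction, \<open>p(c) = (\<Prod>1/r\<^sub>x) (1 + \<Prod>a\<in>A. f\<^sub>a(c\<^sub>a))\<close> with every \<open>f\<^sub>a\<close> of zero sum,
  factorizes along \<open>G\<close>. If it also factorizes along \<open>G'\<close>, take \<open>x \<in> A\<close> without
  descendants in \<open>A\<close> and compare the marginals of \<open>p\<close> on the non-descendants of \<open>x\<close>,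
  with and without \<open>x\<close>: the conditional distribution of \<open>x\<close> given its parents in \<open>G'\<close>
  depends on all of \<open>A\<close>, so \<open>A - {x}\<close> consists of parents of \<open>x\<close> in \<open>G'\<close>.
\<close>

section \<open>The dimension as a sum over sets of variables\<close>

definition family_sets :: "'v set \<Rightarrow> 'v rel \<Rightarrow> 'v set set" where
  "family_sets U G = (\<lambda>(x, B). insert x B) ` (SIGMA x:U. Pow (parents G x))"

text \<open>The index sets are those where the characteristic imset of \<open>G\<close> is 1. The
  summand of \<open>A\<close> is the dimension of the space of pure interactions on
  \<open>A\<close>, as in a log-linear model.\<close>

lemma Dim_eq_sum_family_sets:
  assumes U: "finite U" and S: "\<forall>x\<in>U. finite (S x) \<and> 2 \<le> card (S x)" and G: "dag U G"
  shows "Dim U S G = (\<Sum>A\<in>family_sets U G. \<Prod>a\<in>A. card (S a) - 1)"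
proof -
  have par: "parents G x \<subseteq> U" "x \<notin> parents G x" for x
    using G by (auto simp: dag_def parents_def acyclic_def)
  then have fin: "finite (parents G x)" for x
    using U finite_subset by blast
  have anti: "(y, x) \<notin> G" if "(x, y) \<in> G" for x y
    using G that by (auto simp: dag_def acyclic_def dest: trancl_into_trancl[OF r_into_trancl])
  \<comment> \<open>If one set arose from two different child nodes, each would be a parent of the
    other, a cycle of length two.\<close>
  have inj: "inj_on (\<lambda>(x, B). insert x B) (SIGMA x:U. Pow (parents G x))"
  proof (rule inj_onI, clarsimp)
    fix x B y B'
    assume *: "B \<subseteq> parents G x" "B' \<subseteq> parents G y" "insert x B = insert y B'"
    have "x = y"
    proof (rule ccontr)
      assume "x \<noteq> y"
      then have "(y, x) \<in> G" "(x, y) \<in> G"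
        using * by (auto simp: parents_def)
      then show False
        using anti by blast
    qed
    then show "x = y \<and> B = B'"
      using * par(2) by (metis insert_ident subsetD)
  qed
  have "(card (S x) - 1) * (\<Prod>y\<in>parents G x. card (S y))
      = (\<Sum>B\<in>Pow (parents G x). \<Prod>a\<in>insert x B. card (S a) - 1)" for x
  proof -
    \<comment> \<open>Subtraction on naturals is harmless here because every state set is
      non-empty.\<close>
    have "(\<Prod>y\<in>parents G x. card (S y)) = (\<Prod>y\<in>parents G x. (card (S y) - 1) + 1)"
      using S par(1) by (intro prod.cong) fastforce+
    also have "\<dots> = (\<Sum>B\<in>Pow (parents G x). \<Prod>a\<in>B. card (S a) - 1)"
      using fin by (subst prod_add) auto
    finally have "(card (S x) - 1) * (\<Prod>y\<in>parents G x. card (S y))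
        = (\<Sum>B\<in>Pow (parents G x). (card (S x) - 1) * (\<Prod>a\<in>B. card (S a) - 1))"
      by (simp only: sum_distrib_left)
    also have "\<dots> = (\<Sum>B\<in>Pow (parents G x). \<Prod>a\<in>insert x B. card (S a) - 1)"
    proof (intro sum.cong refl)
      fix B assume "B \<in> Pow (parents G x)"
      then have "finite B" "x \<notin> B"
        using fin[of x] par(2)[of x] finite_subset by blast+
      then show "(card (S x) - 1) * (\<Prod>a\<in>B. card (S a) - 1) = (\<Prod>a\<in>insert x B. card (S a) - 1)"
        by simp
    qed
    finally show ?thesis .
  qed
  then have "Dim U S G = (\<Sum>(x, B)\<in>(SIGMA x:U. Pow (parents G x)). \<Prod>a\<in>insert x B. card (S a) - 1)"
    using U fin by (simp add: Dim_def sum.Sigma)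
  also have "\<dots> = (\<Sum>A\<in>family_sets U G. \<Prod>a\<in>A. card (S a) - 1)"
    unfolding family_sets_def by (subst sum.reindex[OF inj]) (auto intro!: sum.cong)
  finally show ?thesis .
qed

section \<open>Marginals on ancestrally closed sets\<close>

lemma acyclic_sink:
  assumes "finite D" "D \<noteq> {}" "acyclic G"
  obtains y where "y \<in> D" "\<And>x. x \<in> D \<Longrightarrow> (y, x) \<notin> G\<^sup>+"
proof -
  \<comment> \<open>The closure is restricted to \<open>D\<close>, rather than the restriction
    closed, since a path between members of \<open>D\<close> may run outside
    \<open>D\<close>.\<close>
  have "acyclic (G\<^sup>+ \<inter> D \<times> D)"
    using assms(3) by (intro acyclic_subset[OF _ Int_lower1]) (simp add: acyclic_def trancl_id)
  then have "wf ((G\<^sup>+ \<inter> D \<times> D)\<inverse>)"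
    using assms(1) by (intro finite_acyclic_wf_converse) auto
  moreover obtain z where "z \<in> D"
    using assms(2) by blast
  ultimately obtain y where "y \<in> D" "\<And>x. (x, y) \<in> (G\<^sup>+ \<inter> D \<times> D)\<inverse> \<Longrightarrow> x \<notin> D"
    by (rule wfE_min) blast
  then show ?thesis
    using that[of y] by blast
qed

text \<open>Since \<open>V\<close> is closed under parents, the variables of \<open>D\<close> can be
  summed out one at a time, always a sink of those left: only its own factor mentions it, and that
  factor sums to 1.\<close>

lemma joint_marginal:
  assumes "finite D" "finite V" "V \<inter> D = {}" "acyclic G"
    and "\<And>x. x \<in> D \<Longrightarrow> parents G x \<subseteq> V \<union> D" "\<And>x. x \<in> V \<Longrightarrow> parents G x \<subseteq> V"
    and "\<And>x. x \<in> D \<Longrightarrow> finite (S x)"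
    and "\<And>x \<pi>. x \<in> D \<Longrightarrow> \<pi> \<in> PiE (parents G x) S \<Longrightarrow> set_pmf (\<theta> x \<pi>) \<subseteq> S x"
    and "\<And>x. x \<in> V \<Longrightarrow> d x \<in> S x"
  shows "(\<Sum>e\<in>PiE D S. joint (V \<union> D) G \<theta> (override_on d e D)) = joint V G \<theta> d"
  using assms
proof (induction D rule: finite_psubset_induct)
  case (psubset D)
  note fin = psubset.prems(1) and disj = psubset.prems(2) and acyc = psubset.prems(3)
    and parD = psubset.prems(4) and parV = psubset.prems(5) and finS = psubset.prems(6)
    and supp = psubset.prems(7) and dV = psubset.prems(8)
  show ?case
  proof (cases "D = {}")
    case False
    then obtain y where y: "y \<in> D" "\<And>x. x \<in> D \<Longrightarrow> (y, x) \<notin> G\<^sup>+"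
      using acyclic_sink[OF psubset.hyps(1) False acyc] by blast
    define D' where "D' = D - {y}"
    have D: "D = insert y D'" "y \<notin> D'" "y \<notin> V" "finite D'"
      using y disj psubset.hyps(1) by (auto simp: D'_def)
    have parD': "parents G x \<subseteq> V \<union> D'" if "x \<in> D" for x
      using parD[OF that] y(2)[OF that] by (auto simp: D'_def parents_def)
    \<comment> \<open>The two assignments differ only at \<open>y\<close>, which is a parent of no
      variable in \<open>V \<union> D\<close>, so the state \<open>s\<close> enters only through the
      factor of \<open>y\<close>.\<close>
    have split: "joint (V \<union> D) G \<theta> (override_on d (e(y := s)) D)
        = pmf (\<theta> y (restrict (override_on d e D') (parents G y))) s
          * joint (V \<union> D') G \<theta> (override_on d e D')" for e s
    proof -
      let ?c = "override_on d (e(y := s)) D" and ?c' = "override_on d e D'"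
      have eq: "?c x = ?c' x" if "x \<noteq> y" for x
        using that D by (auto simp: override_on_def)
      have restr: "restrict ?c (parents G x) = restrict ?c' (parents G x)" if "x \<in> V \<union> D" for x
      proof -
        have "y \<notin> parents G x"
          using that parD' parV D by blast
        then show ?thesis
          using eq by (intro restrict_ext) metis
      qed
      have "joint (V \<union> D) G \<theta> ?c = pmf (\<theta> y (restrict ?c (parents G y))) (?c y)
          * (\<Prod>x\<in>V \<union> D'. pmf (\<theta> x (restrict ?c (parents G x))) (?c x))"
        unfolding joint_def using D fin by simp
      also have "(\<Prod>x\<in>V \<union> D'. pmf (\<theta> x (restrict ?c (parents G x))) (?c x)) = joint (V \<union> D') G \<theta> ?c'"
        unfolding joint_def
      proof (intro prod.cong refl)
        fix x assume "x \<in> V \<union> D'"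
        then have "x \<noteq> y" "x \<in> V \<union> D"
          using D by auto
        then show "pmf (\<theta> x (restrict ?c (parents G x))) (?c x)
            = pmf (\<theta> x (restrict ?c' (parents G x))) (?c' x)"
          using eq restr by simp
      qed
      finally show ?thesis
        unfolding restr[OF UnI2[OF y(1)]] using y(1) by (simp only: override_on_apply_in fun_upd_same)
    qed
    have "(\<Sum>e\<in>PiE D S. joint (V \<union> D) G \<theta> (override_on d e D))
        = (\<Sum>(s, e)\<in>S y \<times> PiE D' S. joint (V \<union> D) G \<theta> (override_on d (e(y := s)) D))"
      unfolding D(1) PiE_insert_eq
      by (subst sum.reindex[OF inj_combinator[OF D(2)]]) (auto simp: case_prod_unfold)
    also have "\<dots> = (\<Sum>e\<in>PiE D' S. (\<Sum>s\<in>S y. pmf (\<theta> y (restrict (override_on d e D') (parents G y))) s)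
          * joint (V \<union> D') G \<theta> (override_on d e D'))"
      by (subst sum.cartesian_product[symmetric], subst sum.swap) (simp add: split sum_distrib_right)
    also have "\<dots> = (\<Sum>e\<in>PiE D' S. joint (V \<union> D') G \<theta> (override_on d e D'))"
    proof (intro sum.cong refl)
      fix e assume e: "e \<in> PiE D' S"
      \<comment> \<open>The conditional distribution is known to live on \<open>S y\<close> only for
        a legal assignment to the parents.\<close>
      have "restrict (override_on d e D') (parents G y) \<in> PiE (parents G y) S"
        using e dV parD'[OF y(1)] by (auto simp: override_on_def PiE_iff)
      then have "(\<Sum>s\<in>S y. pmf (\<theta> y (restrict (override_on d e D') (parents G y))) s) = 1"
        using y(1) supp finS by (intro sum_pmf_eq_1)
      then show "(\<Sum>s\<in>S y. pmf (\<theta> y (restrict (override_on d e D') (parents G y))) s)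
          * joint (V \<union> D') G \<theta> (override_on d e D') = joint (V \<union> D') G \<theta> (override_on d e D')"
        by simp
    qed
    also have "\<dots> = joint V G \<theta> d"
    proof (rule psubset.IH)
      show "D' \<subset> D" using D by auto
    qed (use D parD' parV finS supp dV fin disj acyc in auto)
    finally show ?thesis .
  qed simp
qed

text \<open>Gives the same marginals in closed form: both summands of the perturbed uniform
  distribution are products of functions of one variable.\<close>

lemma product_marginal:
  fixes h :: "'v \<Rightarrow> 's \<Rightarrow> real"
  assumes "finite D" "finite V" "V \<inter> D = {}" "\<And>x. x \<in> D \<Longrightarrow> finite (S x)"
  shows "(\<Sum>e\<in>PiE D S. \<Prod>x\<in>V \<union> D. h x (override_on d e D x))
       = (\<Prod>x\<in>V. h x (d x)) * (\<Prod>x\<in>D. \<Sum>s\<in>S x. h x s)"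
proof -
  have "(\<Prod>x\<in>V \<union> D. h x (override_on d e D x)) = (\<Prod>x\<in>V. h x (d x)) * (\<Prod>x\<in>D. h x (e x))" for e
  proof -
    have "(\<Prod>x\<in>V. h x (override_on d e D x)) = (\<Prod>x\<in>V. h x (d x))"
      using assms(3) by (intro prod.cong) (auto simp: override_on_def)
    then show ?thesis
      using assms by (simp add: prod.union_disjoint)
  qed
  then show ?thesis
    using assms by (simp add: prod_sum_PiE sum_distrib_left)
qed

section \<open>Networks that realize a pure interaction\<close>

lemma ex_pmf_of_finite_weights:
  fixes f :: "'s \<Rightarrow> real"
  assumes "finite A" "\<And>s. s \<in> A \<Longrightarrow> 0 \<le> f s" "(\<Sum>s\<in>A. f s) = 1"
  obtains p where "set_pmf p \<subseteq> A" "\<And>s. s \<in> A \<Longrightarrow> pmf p s = f s"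
proof -
  \<comment> \<open>\<open>embed_pmf\<close> needs non-negative weights of total mass 1 on the whole
    type, while \<open>f\<close> is arbitrary outside \<open>A\<close>.\<close>
  define g where "g s = (if s \<in> A then f s else 0)" for s
  have nonneg: "0 \<le> g s" for s
    using assms by (simp add: g_def)
  have "(\<integral>\<^sup>+ s. ennreal (g s) \<partial>count_space UNIV) = (\<integral>\<^sup>+ s. ennreal (g s) \<partial>count_space A)"
    by (intro nn_integral_count_space_eq) (auto simp: g_def)
  also have "\<dots> = ennreal (\<Sum>s\<in>A. g s)"
    using assms(1) by (simp add: nn_integral_count_space_finite nonneg sum_ennreal)
  also have "\<dots> = 1"
    using assms(3) by (simp add: g_def)
  finally have "pmf (embed_pmf g) s = g s" for s
    by (intro pmf_embed_pmf nonneg)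
  then show ?thesis
    by (intro that[of "embed_pmf g"]) (auto simp: g_def set_pmf_iff split: if_splits)
qed

text \<open>The whole interaction fits into the conditional distribution of one variable
  \<open>x0\<close>, whose parents include the rest of \<open>A\<close>; all other conditional
  distributions are uniform.\<close>

lemma ex_interaction_net:
  fixes f :: "'v \<Rightarrow> 's \<Rightarrow> real"
  assumes U: "finite U" and S: "\<forall>x\<in>U. finite (S x) \<and> 2 \<le> card (S x)" and G: "dag U G"
    and A: "A \<in> family_sets U G"
    and f_le: "\<And>x s. \<bar>f x s\<bar> \<le> 1" and f_sum: "\<And>x. x \<in> U \<Longrightarrow> (\<Sum>s\<in>S x. f x s) = 0"
  obtains \<theta> where "bayes_net U S G \<theta>"
    "\<And>c. c \<in> PiE U S \<Longrightarrow> joint U G \<theta> c = (\<Prod>x\<in>U. 1 / card (S x)) * (1 + (\<Prod>a\<in>A. f a (c a)))"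
proof -
  obtain x0 B where A_eq: "A = insert x0 B" and x0: "x0 \<in> U" and B: "B \<subseteq> parents G x0"
    using A by (auto simp: family_sets_def)
  have par: "parents G x0 \<subseteq> U" "x0 \<notin> parents G x0"
    using G by (auto simp: dag_def parents_def acyclic_def)
  have finB: "finite B" and x0B: "x0 \<notin> B"
    using B par U by (auto intro: finite_subset)
  have ne: "S x \<noteq> {}" and card_pos: "0 < card (S x)" if "x \<in> U" for x
    using S that by force+
  have prod_le: "\<bar>\<Prod>a\<in>T. f a (\<pi> a)\<bar> \<le> 1" for T \<pi>
    unfolding abs_prod using f_le by (intro prod_le_1) auto
  \<comment> \<open>The weights are non-negative because the product lies between -1 and 1, and sum
    to 1 because \<open>f x0\<close> sums to 0.\<close>
  define w where "w \<pi> s = 1 / card (S x0) * (1 + f x0 s * (\<Prod>a\<in>B. f a (\<pi> a)))" for \<pi> s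
  have "\<exists>p. set_pmf p \<subseteq> S x0 \<and> (\<forall>s\<in>S x0. pmf p s = w \<pi> s)" for \<pi>
  proof (rule ex_pmf_of_finite_weights)
    show "finite (S x0)" using S x0 by auto
    have bound: "\<bar>f x0 s * (\<Prod>a\<in>B. f a (\<pi> a))\<bar> \<le> 1" for s
      using f_le prod_le by (simp add: abs_mult mult_le_one)
    show "0 \<le> w \<pi> s" for s
      using bound[of s] unfolding w_def by (intro mult_nonneg_nonneg) (auto simp: abs_le_iff)
    show "sum (w \<pi>) (S x0) = 1"
      using card_pos[OF x0] f_sum[OF x0]
      by (simp add: w_def sum_distrib_left[symmetric] sum_distrib_right[symmetric] sum.distrib
          sum_divide_distrib[symmetric])
  qed blast
  then obtain q where q: "\<And>\<pi>. set_pmf (q \<pi>) \<subseteq> S x0" "\<And>\<pi> s. s \<in> S x0 \<Longrightarrow> pmf (q \<pi>) s = w \<pi> s"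
    by metis
  define \<theta> where "\<theta> = (\<lambda>x \<pi>. if x = x0 then q \<pi> else pmf_of_set (S x))"
  show ?thesis
  proof (rule that[of \<theta>])
    show "bayes_net U S G \<theta>"
      using G S ne q(1) by (auto simp: bayes_net_def \<theta>_def)
  next
    fix c assume c: "c \<in> PiE U S"
    have "joint U G \<theta> c = pmf (\<theta> x0 (restrict c (parents G x0))) (c x0)
        * (\<Prod>x\<in>U - {x0}. pmf (\<theta> x (restrict c (parents G x))) (c x))"
      unfolding joint_def using U x0 by (rule prod.remove)
    also have "pmf (\<theta> x0 (restrict c (parents G x0))) (c x0)
        = 1 / card (S x0) * (1 + f x0 (c x0) * (\<Prod>a\<in>B. f a (c a)))"
    proof -
      have "(\<Prod>a\<in>B. f a (restrict c (parents G x0) a)) = (\<Prod>a\<in>B. f a (c a))"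
        using B by (intro prod.cong) auto
      moreover have "c x0 \<in> S x0"
        using c x0 by auto
      ultimately show ?thesis
        by (simp only: \<theta>_def q(2) w_def if_True simp_thms)
    qed
    also have "f x0 (c x0) * (\<Prod>a\<in>B. f a (c a)) = (\<Prod>a\<in>A. f a (c a))"
      using finB x0B by (simp add: A_eq)
    also have "(\<Prod>x\<in>U - {x0}. pmf (\<theta> x (restrict c (parents G x))) (c x))
        = (\<Prod>x\<in>U - {x0}. 1 / card (S x))"
      using S ne c by (intro prod.cong) (auto simp: \<theta>_def pmf_of_set indicator_def)
    finally show "joint U G \<theta> c = (\<Prod>x\<in>U. 1 / card (S x)) * (1 + (\<Prod>a\<in>A. f a (c a)))"
      using U x0 by (simp add: prod.remove)
  qed
qed

text \<open>Converse to \<open>ex_interaction_net\<close>. The states \<open>u\<close> and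
  \<open>v\<close> are probes: switching one coordinate in \<open>A\<close> from \<open>u\<close> to
  \<open>v\<close> flips the sign of the interaction.\<close>

lemma family_set_of_interaction_net:
  fixes f :: "'v \<Rightarrow> 's \<Rightarrow> real"
  assumes U: "finite U" and S: "\<forall>x\<in>U. finite (S x) \<and> 2 \<le> card (S x)"
    and A: "A \<subseteq> U" "A \<noteq> {}" and net: "bayes_net U S G \<theta>"
    and joint: "\<And>c. c \<in> PiE U S \<Longrightarrow>
      joint U G \<theta> c = (\<Prod>x\<in>U. 1 / card (S x)) * (1 + (\<Prod>a\<in>A. f a (c a)))"
    and f_sum: "\<And>x. x \<in> U \<Longrightarrow> (\<Sum>s\<in>S x. f x s) = 0"
    and u: "\<And>x. x \<in> U \<Longrightarrow> u x \<in> S x \<and> f x (u x) = 1"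
    and v: "\<And>x. x \<in> U \<Longrightarrow> v x \<in> S x \<and> f x (v x) = - 1"
  shows "A \<in> family_sets U G"
proof -
  have G: "G \<subseteq> U \<times> U" "acyclic G" and supp: "\<And>x \<pi>. x \<in> U \<Longrightarrow> \<pi> \<in> PiE (parents G x) S \<Longrightarrow> set_pmf (\<theta> x \<pi>) \<subseteq> S x"
    using net by (auto simp: bayes_net_def dag_def)
  have finA: "finite A"
    using A U finite_subset by blast
  have card_pos: "0 < card (S x)" if "x \<in> U" for x
    using S that by force
  obtain x where x: "x \<in> A" "\<And>y. y \<in> A \<Longrightarrow> (x, y) \<notin> G\<^sup>+"
    using acyclic_sink[OF finA A(2) G(2)] by blast
  \<comment> \<open>The non-descendants of \<open>x\<close>, with \<open>x\<close> itself. Both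
    \<open>V\<close> and \<open>V - {x}\<close> are closed under parents, so both marginals can be
    computed.\<close>
  define V where "V = {y \<in> U. (x, y) \<notin> G\<^sup>+}"
  have xV: "x \<in> V" and AV: "A \<subseteq> V" and VU: "V \<subseteq> U" and finV: "finite V"
    using x A U by (auto simp: V_def)
  have anc: "parents G y \<subseteq> V" if "y \<in> V" for y
    using that G(1) by (auto simp: V_def parents_def intro: trancl_into_trancl)
  have anc': "parents G y \<subseteq> V - {x}" if "y \<in> V" for y
    using that anc[OF that] by (auto simp: V_def parents_def)
  define k where "k W = (\<Prod>y\<in>W. 1 / real (card (S y)))" for W
  \<comment> \<open>Summing out any member of \<open>A\<close> kills the interaction, as its
    \<open>f\<close> has zero sum; otherwise the interaction survives unchanged.\<close>
  have marginal: "joint W G \<theta> d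
      = k W * (1 + (if A \<subseteq> W then \<Prod>a\<in>A. f a (d a) else 0))"
    if W: "W \<subseteq> U" "\<And>y. y \<in> W \<Longrightarrow> parents G y \<subseteq> W" "\<And>y. y \<in> W \<Longrightarrow> d y \<in> S y" for W d
  proof -
    define D where "D = U - W"
    have D: "W \<union> D = U" "finite D" "finite W" "W \<inter> D = {}" "D \<subseteq> U"
      using W U by (auto simp: D_def intro: finite_subset)
    \<comment> \<open>Absorbs the uniform weight and the interaction into one product over single
      variables.\<close>
    define h where "h y s = 1 / real (card (S y)) * (if y \<in> A then f y s else 1)" for y s
    have h_prod: "(\<Prod>y\<in>T. h y (c y)) = k T * (\<Prod>a\<in>A. f a (c a))" if "A \<subseteq> T" "finite T" for T c
      unfolding h_def k_def prod.distrib
      using that by (simp add: prod.If_cases Int_absorb1)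
    have h_sum: "(\<Sum>s\<in>S y. h y s) = (if y \<in> A then 0 else 1)" if "y \<in> U" for y
      using that f_sum card_pos[OF that]
      by (simp add: h_def sum_divide_distrib[symmetric])
    have "joint W G \<theta> d = (\<Sum>e\<in>PiE D S. joint (W \<union> D) G \<theta> (override_on d e D))"
    proof (intro joint_marginal[symmetric] W(2,3))
      show "parents G y \<subseteq> W \<union> D" for y
        using G(1) D(1) by (auto simp: parents_def)
    qed (use D S supp G in blast)+
    also have "\<dots> = (\<Sum>e\<in>PiE D S. (\<Prod>y\<in>W \<union> D. 1 / real (card (S y)))
        + (\<Prod>y\<in>W \<union> D. h y (override_on d e D y)))"
    proof (intro sum.cong refl)
      fix e assume e: "e \<in> PiE D S"
      \<comment> \<open>The formula for the joint distribution is available only for members of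
        \<open>PiE U S\<close>, which are undefined outside \<open>U\<close>.\<close>
      define c where "c = restrict (override_on d e D) U"
      have c: "c \<in> PiE U S"
        using e W D by (auto simp: c_def override_on_def)
      have "restrict c (parents G y) = restrict (override_on d e D) (parents G y)" for y
        using G(1) by (auto simp: c_def parents_def restrict_def fun_eq_iff)
      then have "joint U G \<theta> (override_on d e D) = joint U G \<theta> c"
        unfolding joint_def by (intro prod.cong) (auto simp: c_def)
      also have "\<dots> = k U + k U * (\<Prod>a\<in>A. f a (c a))"
        unfolding k_def joint[OF c] by (simp add: distrib_left)
      also have "k U * (\<Prod>a\<in>A. f a (c a)) = (\<Prod>y\<in>U. h y (c y))"
        using h_prod A U by simp
      also have "\<dots> = (\<Prod>y\<in>U. h y (override_on d e D y))"
        by (intro prod.cong) (auto simp: c_def)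
      finally show "joint (W \<union> D) G \<theta> (override_on d e D)
          = (\<Prod>y\<in>W \<union> D. 1 / real (card (S y))) + (\<Prod>y\<in>W \<union> D. h y (override_on d e D y))"
        unfolding D(1) k_def .
    qed
    also have "\<dots> = k W * (\<Prod>y\<in>D. \<Sum>s\<in>S y. 1 / real (card (S y)))
        + (\<Prod>y\<in>W. h y (d y)) * (\<Prod>y\<in>D. \<Sum>s\<in>S y. h y s)"
      unfolding sum.distrib k_def using D S
      by (intro arg_cong2[where f = "(+)"] product_marginal[where h = "\<lambda>y s. 1 / real (card (S y))"]
          product_marginal[where h = h]) auto
    also have "(\<Prod>y\<in>D. \<Sum>s\<in>S y. 1 / real (card (S y))) = 1"
      using D card_pos by (intro prod.neutral) auto
    also have "(\<Prod>y\<in>D. \<Sum>s\<in>S y. h y s) = (if A \<subseteq> W then 1 else 0)"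
    proof (cases "A \<subseteq> W")
      case True
      then show ?thesis
        using D h_sum by (auto intro!: prod.neutral)
    next
      case False
      then obtain a where "a \<in> A" "a \<in> D"
        using A D by blast
      then show ?thesis
        using False D h_sum[of a] by (auto intro!: prod_zero)
    qed
    finally show ?thesis
      using h_prod[of W d] D by (auto simp: distrib_left)
  qed
  \<comment> \<open>Quotient of the marginals on \<open>V\<close> and \<open>V - {x}\<close>; the
    latter is uniform, since \<open>V - {x}\<close> does not contain \<open>A\<close>.\<close>
  have cond: "pmf (\<theta> x (restrict d (parents G x))) (d x) = (1 + (\<Prod>a\<in>A. f a (d a))) / card (S x)"
    if d: "\<And>y. y \<in> V \<Longrightarrow> d y \<in> S y" for d
  proof -
    have "joint V G \<theta> d = pmf (\<theta> x (restrict d (parents G x))) (d x) * joint (V - {x}) G \<theta> d"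
      unfolding joint_def using finV xV by (rule prod.remove)
    moreover have "joint V G \<theta> d = k V * (1 + (\<Prod>a\<in>A. f a (d a)))"
      using marginal[OF VU anc d] AV by simp
    moreover have "joint (V - {x}) G \<theta> d = k (V - {x})"
    proof -
      have "V - {x} \<subseteq> U" "\<not> A \<subseteq> V - {x}"
        using VU x(1) by auto
      then show ?thesis
        using marginal[of "V - {x}" d] anc' d by simp
    qed
    moreover have "k V = 1 / card (S x) * k (V - {x})"
      unfolding k_def using finV xV by (rule prod.remove)
    ultimately have "k (V - {x}) * pmf (\<theta> x (restrict d (parents G x))) (d x)
        = k (V - {x}) * ((1 + (\<Prod>a\<in>A. f a (d a))) / card (S x))"
      by (simp add: mult.commute)
    moreover have "k (V - {x}) \<noteq> 0"
      unfolding k_def using VU card_pos finV by (subst prod_zero_iff) (auto simp: subset_iff dest!: card_pos)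
    ultimately show ?thesis
      by (simp only: mult_cancel_left simp_thms)
  qed
  have "a \<in> parents G x" if a: "a \<in> A" "a \<noteq> x" for a
  proof (rule ccontr)
    assume a_par: "a \<notin> parents G x"
    \<comment> \<open>If \<open>a\<close> were not a parent of \<open>x\<close>, then
      \<open>u\<close> and \<open>d\<close> would give \<open>x\<close> the same conditional
      probability, yet \<open>cond\<close> yields \<open>2 / card (S x)\<close> for \<open>u\<close>
      and 0 for \<open>d\<close>.\<close>
    define d where "d = u(a := v a)"
    have "(\<Prod>b\<in>A. f b (u b)) = 1"
      using u A by (intro prod.neutral) auto
    moreover have "(\<Prod>b\<in>A. f b (d b)) = - 1"
    proof -
      have "(\<Prod>b\<in>A. f b (d b)) = f a (d a) * (\<Prod>b\<in>A - {a}. f b (d b))"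
        using finA a(1) by (rule prod.remove)
      also have "(\<Prod>b\<in>A - {a}. f b (d b)) = 1"
        using u A by (intro prod.neutral) (auto simp: d_def)
      finally show ?thesis
        using v a A by (auto simp: d_def)
    qed
    moreover have "restrict d (parents G x) = restrict u (parents G x)" "d x = u x"
      using a_par a by (auto simp: d_def restrict_def fun_eq_iff)
    moreover have "u y \<in> S y" "d y \<in> S y" if "y \<in> V" for y
      using that u v VU by (auto simp: d_def)
    ultimately show False
      using cond[of u] cond[of d] card_pos[of x] x A by auto
  qed
  then have "A = insert x (A - {x})" "A - {x} \<subseteq> parents G x" "x \<in> U"
    using x A by auto
  then show ?thesis
    unfolding family_sets_def by (intro image_eqI[of _ _ "(x, A - {x})"]) auto
qed

lemma family_sets_subset:
  fixes S :: "'v \<Rightarrow> 's set"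
  assumes U: "finite U" and S: "\<forall>x\<in>U. finite (S x) \<and> 2 \<le> card (S x)" and G: "dag U G"
    and equiv: "dag_equiv U S G G'"
  shows "family_sets U G \<subseteq> family_sets U G'"
proof
  fix A assume A: "A \<in> family_sets U G"
  then have A': "A \<subseteq> U" "A \<noteq> {}"
    using G by (auto simp: family_sets_def dag_def parents_def)
  have "\<exists>u v. u \<in> S x \<and> v \<in> S x \<and> u \<noteq> v" if "x \<in> U" for x
    using S that by (metis card_le_Suc0_iff_eq not_less_eq_eq numeral_2_eq_2)
  then obtain u v where uv: "\<And>x. x \<in> U \<Longrightarrow> u x \<in> S x \<and> v x \<in> S x \<and> u x \<noteq> v x"
    by metis
  \<comment> \<open>A difference of two point indicators has zero sum, is bounded by 1 and attains
    both 1 and -1.\<close>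
  define f :: "'v \<Rightarrow> 's \<Rightarrow> real"
    where "f x s = (if s = u x then 1 else 0) - (if s = v x then 1 else 0)" for x s
  have f_le: "\<bar>f x s\<bar> \<le> 1" for x s
    by (simp add: f_def)
  have f_sum: "(\<Sum>s\<in>S x. f x s) = 0" if "x \<in> U" for x
    using S uv that by (simp add: f_def sum_subtractf)
  obtain \<theta> where \<theta>: "bayes_net U S G \<theta>"
    "\<And>c. c \<in> PiE U S \<Longrightarrow> joint U G \<theta> c = (\<Prod>x\<in>U. 1 / card (S x)) * (1 + (\<Prod>a\<in>A. f a (c a)))"
    using ex_interaction_net[OF U S G A f_le f_sum] by blast
  obtain \<theta>' where \<theta>': "bayes_net U S G' \<theta>'"
    "\<And>c. c \<in> PiE U S \<Longrightarrow> joint U G' \<theta>' c = joint U G \<theta> c"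
    using equiv[unfolded dag_equiv_def, THEN conjunct1, rule_format, OF \<theta>(1)] by auto
  show "A \<in> family_sets U G'"
  proof (rule family_set_of_interaction_net[OF U S A' \<theta>'(1) _ f_sum])
    show "joint U G' \<theta>' c = (\<Prod>x\<in>U. 1 / card (S x)) * (1 + (\<Prod>a\<in>A. f a (c a)))"
      if "c \<in> PiE U S" for c
      using \<theta>(2) \<theta>'(2) that by simp
    show "u x \<in> S x \<and> f x (u x) = 1" "v x \<in> S x \<and> f x (v x) = - 1" if "x \<in> U" for x
      using uv[OF that] by (auto simp: f_def)
  qed
qed

section \<open>Invariance of dimension and maximum likelihood\<close>

lemma dag_equiv_sym: "dag_equiv U S G G' \<Longrightarrow> dag_equiv U S G' G"
  by (simp add: dag_equiv_def)

text \<open>Transferring interaction networks in both directions makes the family sets equal, and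
  the summand of each set does not depend on the dag.\<close>

lemma dag_equiv_Dim_eq:
  assumes "finite U" "\<forall>x\<in>U. finite (S x) \<and> 2 \<le> card (S x)" "dag U G" "dag U G'"
    and "dag_equiv U S G G'"
  shows "Dim U S G = Dim U S G'"
proof -
  have "family_sets U G = family_sets U G'"
    using family_sets_subset assms dag_equiv_sym by (metis subset_antisym)
  then show ?thesis
    using assms by (simp add: Dim_eq_sum_family_sets)
qed

text \<open>The two sets of attainable likelihoods coincide, so \<open>GREATEST\<close> is applied
  to the same predicate and no maximizers need to be compared.\<close>

lemma dag_equiv_M_ML_eq:
  assumes C: "database U S C" and equiv: "dag_equiv U S G G'"
  shows "M_ML U S G C = M_ML U S G' C"
proof -
  have "likelihood U H \<theta> C = likelihood U H' \<theta>' C"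
    if "\<forall>c\<in>PiE U S. joint U H \<theta> c = joint U H' \<theta>' c" for H H' \<theta> \<theta>'
    unfolding likelihood_def using that C
    by (intro prod.cong refl) (metis database_def lessThan_iff nth_mem subsetD)
  then have "(\<exists>\<theta>. bayes_net U S G \<theta> \<and> m = likelihood U G \<theta> C)
      \<longleftrightarrow> (\<exists>\<theta>. bayes_net U S G' \<theta> \<and> m = likelihood U G' \<theta> C)" for m
    using equiv unfolding dag_equiv_def by metis
  then show ?thesis
    by (simp add: M_ML_def)
qed

theorem theorem5:
  fixes U :: "'v set" and S :: "'v \<Rightarrow> 's set"
  assumes "finite U"
    and "\<forall>x\<in>U. finite (S x) \<and> 2 \<le> card (S x)"
  shows "score_equivalent U S (M_BIC U S)"
  unfolding score_equivalent_def
proof (intro allI impI)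
  fix G G' C
  assume "dag U G" "dag U G'" "database U S C" "dag_equiv U S G G'"
  then show "M_BIC U S G C = M_BIC U S G' C"
    unfolding M_BIC_def using dag_equiv_M_ML_eq[of U S C G G'] dag_equiv_Dim_eq[OF assms, of G G'] by simp
qed

end
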